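(* Fix $m>2$, $\delta_s,\delta_r\in(0,1)$, $\theta\in(0,1]$, $N_0>0$, $\sigma_{sd},\sigma_{sr},\sigma_{rd}>0$, and, for total power $P>0$, put $P_s=\theta P$, $P_r=(1-\theta)P$ and $\mathrm{SNR}=P/N_0$. Let $I_{low}(\mathrm{SNR})$ be the achievable rate, as defined in the context, of any one of the three transmission schemes: amplify-and-forward (with $0<\alpha\le 1/2$), decode-and-forward with repetition channel coding (with $0<\alpha\le 1/2$), or decode-and-forward with parallel channel coding (with $0<\alpha<1$). Then the normalized bit energy grows without bound as the signal-to-noise ratio decreases to zero, i.e. $$\left.\frac{E_{b,U}}{N_0}\right|_{I_{low}=0}=\lim_{\mathrm{SNR}\to0^+}\frac{\mathrm{SNR}}{I_{low}(\mathrm{SNR})}=\frac{1}{\dot I_{low}(0)}=\infty ,$$ where $\dot I_{low}(0)$ is the (one-sided) derivative of $I_{low}$ with respect to $\mathrm{SNR}$ at $0$, and $1/\dot I_{low}(0)=\infty$ means $\dot I_{low}(0)=0$.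
   Context: The normalized bit energy is $\frac{E_{b,U}}{N_0}=\frac{\mathrm{SNR}}{I_{low}(\mathrm{SNR})}$. Logarithms are base 2 (rates in bits/symbol), and $I_{low}(0)=0$. Let $w_{sd},w_{sr},w_{rd}$ be i.i.d. proper complex Gaussian with mean $0$ and variance $1$. Put $A=\sigma_{sd}^2\delta_s mP_s+N_0$, $B=\sigma_{rd}^2\delta_r mP_r+N_0$, $C=\sigma_{sr}^2\delta_smP_s+N_0$. For the first two schemes, let $D=(m-2)AB N_0+(1-\delta_r)mP_r\sigma_{rd}^2N_0A/\alpha+(1-\delta_s)mP_s\sigma_{sd}^2N_0B$ and $$a=\tfrac{\delta_s(1-\delta_s)m^2P_s^2\sigma_{sd}^4}{(1-\delta_s)mP_s\sigma_{sd}^2N_0+(m-2)AN_0}|w_{sd}|^2,\quad c=\tfrac{\delta_s(1-\delta_s)m^2P_s^2\sigma_{sr}^4}{(1-\delta_s)mP_s\sigma_{sr}^2N_0+(m-2)CN_0}|w_{sr}|^2,$$ $$b=\tfrac{\delta_s(1-\delta_s)m^2P_s^2\sigma_{sd}^4B}{D}|w_{sd}|^2,\quad d=\tfrac{\delta_r(1-\delta_r)m^2P_r^2\sigma_{rd}^4A/\alpha}{D}|w_{rd}|^2 .$$ Amplify-and-forward: $I_{low}=\frac1m E\{(1-2\alpha)(m-2)\log(1+a)+(m-2)\alpha\log(1+a+\frac{cd}{1+c+d}+\frac{(1+a)b(1+c)}{1+c+d})\}$. Decode-and-forward, repetition channel coding: $I_{low}=\frac1m\{(1-2\alpha)(m-2)E[\log(1+a)]+(m-2)\alpha\min\{E[\log(1+c)],\,E[\log(1+a+d+b+ab)]\}\}$.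 Decode-and-forward, parallel channel coding: $I_{low}=\min\{E\{\frac{(1-\alpha)(m-2)}m\log(1+c_1)\},\ E\{\frac{(1-\alpha)(m-2)}m\log(1+a_1)+\frac{\alpha(m-2)}m\log(1+d_1)\}\}$, with $$a_1=\tfrac{\delta_s(1-\delta_s)m^2P_s^2\sigma_{sd}^4/(1-\alpha)}{(1-\delta_s)mP_s\sigma_{sd}^2N_0/(1-\alpha)+(m-2)AN_0}|w_{sd}|^2,\quad c_1=\tfrac{\delta_s(1-\delta_s)m^2P_s^2\sigma_{sr}^4/(1-\alpha)}{(1-\delta_s)mP_s\sigma_{sr}^2N_0/(1-\alpha)+(m-2)CN_0}|w_{sr}|^2,$$ $$d_1=\tfrac{\delta_r(1-\delta_r)m^2P_r^2\sigma_{rd}^4/\alpha}{(1-\delta_r)mP_r\sigma_{rd}^2N_0/\alpha+(m-2)BN_0}|w_{rd}|^2 .$$ *)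

theory Defs
  imports "HOL-Probability.Probability"
begin

(* Joint Gaussianity of (Re w, Im w) is expressed by requiring every nontrivial real linear
   combination to be normal; "proper" is the vanishing of the pseudo-variance E[(w - \<mu>)^2].
   Only the nondegenerate case v > 0 is covered. *)
definition proper_complex_gaussian ::
    "'a measure \<Rightarrow> ('a \<Rightarrow> complex) \<Rightarrow> complex \<Rightarrow> real \<Rightarrow> bool" where
  "proper_complex_gaussian M w \<mu> v \<longleftrightarrow>
     w \<in> borel_measurable M \<and>
     (\<forall>s t :: real. (s, t) \<noteq> (0, 0) \<longrightarrow>
        (\<exists>\<nu> \<tau>. \<tau> > 0 \<and>
           distributed M lborel (\<lambda>\<omega>. s * Re (w \<omega>) + t * Im (w \<omega>)) (normal_density \<nu> \<tau>))) \<and>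
     (LINT \<omega>|M. w \<omega>) = \<mu> \<and>
     (LINT \<omega>|M. (cmod (w \<omega> - \<mu>))\<^sup>2) = v \<and>
     (LINT \<omega>|M. (w \<omega> - \<mu>)\<^sup>2) = 0"

(* source-destination, source-relay, relay-destination *)
datatype link = SD | SR | RD

datatype scheme = AF | DF_Repetition | DF_Parallel

fun admissible :: "scheme \<Rightarrow> real \<Rightarrow> bool" where
  "admissible AF \<alpha> \<longleftrightarrow> 0 < \<alpha> \<and> \<alpha> \<le> 1/2"
| "admissible DF_Repetition \<alpha> \<longleftrightarrow> 0 < \<alpha> \<and> \<alpha> \<le> 1/2"
| "admissible DF_Parallel \<alpha> \<longleftrightarrow> 0 < \<alpha> \<and> \<alpha> < 1"

(* The locale carries no assumptions; it only fixes the parameters of the formulas. *)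
locale relay =
  fixes M :: "'a measure"
    and w :: "link \<Rightarrow> 'a \<Rightarrow> complex"
    and m \<delta>s \<delta>r N0 :: real
    and \<sigma> :: "link \<Rightarrow> real"
    and \<alpha> Ps Pr :: real
begin

definition "A = (\<sigma> SD)\<^sup>2 * \<delta>s * m * Ps + N0"
definition "B = (\<sigma> RD)\<^sup>2 * \<delta>r * m * Pr + N0"
definition "C = (\<sigma> SR)\<^sup>2 * \<delta>s * m * Ps + N0"

definition "D = (m - 2) * A * B * N0
  + (1 - \<delta>r) * m * Pr * (\<sigma> RD)\<^sup>2 * N0 * A / \<alpha>
  + (1 - \<delta>s) * m * Ps * (\<sigma> SD)\<^sup>2 * N0 * B"

definition "a \<omega> = \<delta>s * (1 - \<delta>s) * m\<^sup>2 * Ps\<^sup>2 * \<sigma> SD ^ 4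
  / ((1 - \<delta>s) * m * Ps * (\<sigma> SD)\<^sup>2 * N0 + (m - 2) * A * N0) * (cmod (w SD \<omega>))\<^sup>2"

definition "c \<omega> = \<delta>s * (1 - \<delta>s) * m\<^sup>2 * Ps\<^sup>2 * \<sigma> SR ^ 4
  / ((1 - \<delta>s) * m * Ps * (\<sigma> SR)\<^sup>2 * N0 + (m - 2) * C * N0) * (cmod (w SR \<omega>))\<^sup>2"

definition "b \<omega> = \<delta>s * (1 - \<delta>s) * m\<^sup>2 * Ps\<^sup>2 * \<sigma> SD ^ 4 * B / D * (cmod (w SD \<omega>))\<^sup>2"

definition "d \<omega> = (\<delta>r * (1 - \<delta>r) * m\<^sup>2 * Pr\<^sup>2 * \<sigma> RD ^ 4 * A / \<alpha>) / D * (cmod (w RD \<omega>))\<^sup>2"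

definition "a\<^sub>1 \<omega> = (\<delta>s * (1 - \<delta>s) * m\<^sup>2 * Ps\<^sup>2 * \<sigma> SD ^ 4 / (1 - \<alpha>))
  / ((1 - \<delta>s) * m * Ps * (\<sigma> SD)\<^sup>2 * N0 / (1 - \<alpha>) + (m - 2) * A * N0) * (cmod (w SD \<omega>))\<^sup>2"

definition "c\<^sub>1 \<omega> = (\<delta>s * (1 - \<delta>s) * m\<^sup>2 * Ps\<^sup>2 * \<sigma> SR ^ 4 / (1 - \<alpha>))
  / ((1 - \<delta>s) * m * Ps * (\<sigma> SR)\<^sup>2 * N0 / (1 - \<alpha>) + (m - 2) * C * N0) * (cmod (w SR \<omega>))\<^sup>2"

definition "d\<^sub>1 \<omega> = (\<delta>r * (1 - \<delta>r) * m\<^sup>2 * Pr\<^sup>2 * \<sigma> RD ^ 4 / \<alpha>)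
  / ((1 - \<delta>r) * m * Pr * (\<sigma> RD)\<^sup>2 * N0 / \<alpha> + (m - 2) * B * N0) * (cmod (w RD \<omega>))\<^sup>2"

fun rate :: "scheme \<Rightarrow> real" where
  "rate AF = 1 / m * (LINT \<omega>|M.
     (1 - 2 * \<alpha>) * (m - 2) * log 2 (1 + a \<omega>)
     + (m - 2) * \<alpha> * log 2 (1 + a \<omega> + c \<omega> * d \<omega> / (1 + c \<omega> + d \<omega>)
         + (1 + a \<omega>) * b \<omega> * (1 + c \<omega>) / (1 + c \<omega> + d \<omega>)))"
| "rate DF_Repetition = 1 / m *
     ((1 - 2 * \<alpha>) * (m - 2) * (LINT \<omega>|M. log 2 (1 + a \<omega>))
      + (m - 2) * \<alpha> * min (LINT \<omega>|M. log 2 (1 + c \<omega>))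
                          (LINT \<omega>|M. log 2 (1 + a \<omega> + d \<omega> + b \<omega> + a \<omega> * b \<omega>)))"
| "rate DF_Parallel = min
     (LINT \<omega>|M. (1 - \<alpha>) * (m - 2) / m * log 2 (1 + c\<^sub>1 \<omega>))
     (LINT \<omega>|M. (1 - \<alpha>) * (m - 2) / m * log 2 (1 + a\<^sub>1 \<omega>)
                 + \<alpha> * (m - 2) / m * log 2 (1 + d\<^sub>1 \<omega>))"

end

(* The total power is P = snr * N0, split as Ps = \<theta> P and Pr = (1 - \<theta>) P. At snr = 0 all
   the coefficients vanish, so the formulas themselves give rate 0 there. *)
definition I_low :: "'a measure \<Rightarrow> (link \<Rightarrow> 'a \<Rightarrow> complex) \<Rightarrow> real \<Rightarrow> real \<Rightarrow> real \<Rightarrow> real \<Rightarrow>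
    (link \<Rightarrow> real) \<Rightarrow> real \<Rightarrow> real \<Rightarrow> scheme \<Rightarrow> real \<Rightarrow> real" where
  "I_low M w m \<delta>s \<delta>r N0 \<sigma> \<theta> \<alpha> sch snr =
     relay.rate M w m \<delta>s \<delta>r N0 \<sigma> \<alpha> (\<theta> * (snr * N0)) ((1 - \<theta>) * (snr * N0)) sch"

definition normalized_bit_energy :: "(real \<Rightarrow> real) \<Rightarrow> real \<Rightarrow> real" where
  "normalized_bit_energy R snr = snr / R snr"

end

(* The training costs make every effective gain quadratic in the power: its numerator carries
   Ps^2 or Pr^2 while its denominator stays above a positive constant.  Since log (1 + x) <= x / ln 2
   and E |w|^2 = 1, the rate is O(SNR^2), and it is positive for SNR > 0, so SNR / I_low(SNR) >=
   1 / (K SNR).  Products of gains are harmless: the arguments of the logarithms are at most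
   (1 + x)(1 + y)(1 + z) for three of the gains x, y, z. *)
theory Submission
  imports Defs
begin

section \<open>Elementary inequalities for logarithms, fractions and products\<close>

lemma log2_one_plus_le:
  fixes x :: real
  assumes "0 \<le> x"
  shows "log 2 (1 + x) \<le> x / ln 2"
  using ln_add_one_self_le_self[OF assms] by (simp add: log_def divide_right_mono)

lemma log2_one_plus_nonneg [simp]: "0 \<le> log 2 (1 + x)" if "0 \<le> x" for x :: real
  using that by (subst zero_le_log_cancel_iff) auto

text \<open>Decouples the gains: the logarithm of an expression mixing several gains is traded for
  single-gain logarithms, whose expectations are controlled one by one.\<close>

lemma log2_le_sum_log2:
  fixes t x y z :: real
  assumes "0 < t" "t \<le> (1 + x) * (1 + y) * (1 + z)" "0 \<le> x" "0 \<le> y" "0 \<le> z"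
  shows "log 2 t \<le> log 2 (1 + x) + log 2 (1 + y) + log 2 (1 + z)"
proof -
  have "log 2 t \<le> log 2 ((1 + x) * (1 + y) * (1 + z))"
    using assms by simp
  also have "\<dots> = log 2 (1 + x) + log 2 (1 + y) + log 2 (1 + z)"
    using assms by (simp add: log_mult)
  finally show ?thesis .
qed

text \<open>Enlarging the numerator to \<open>p\<close> and shrinking the denominator to
  \<open>z\<close> gives the largest possible quotient; \<open>Q\<close> will be
  \<open>gain_max\<close>.\<close>

lemma frac_bounds:
  fixes x y z p Q :: real
  assumes "0 \<le> x" "x \<le> p" "0 < z" "z \<le> y" "p / z \<le> Q"
  shows "0 \<le> x / y" "x / y \<le> Q" "0 < x \<Longrightarrow> 0 < x / y"
proof -
  have "x / y \<le> p / z"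
    using assms by (intro frac_le) auto
  then show "x / y \<le> Q" using assms by simp
qed (use assms in auto)

text \<open>Serves to drop the factor \<delta> (1 - \<delta>) from the numerators of the
  gains.\<close>

lemma mult_three_le:
  fixes x y z :: real
  assumes "0 \<le> x" "x \<le> 1" "0 \<le> y" "y \<le> 1" "0 \<le> z"
  shows "x * y * z \<le> z"
  using mult_left_le_one_le[of z "x * y"] assms by (simp add: mult_le_one)

section \<open>Expected logarithm of a gain \<open>k * X\<close>, where \<open>X\<close> stands for
  the fading power |w|^2 and \<open>k\<close> for its deterministic coefficient\<close>

context prob_space
begin

context
  fixes X :: "'a \<Rightarrow> real" and k :: real
  assumes X_int: "integrable M X" and X_nonneg: "\<And>\<omega>. 0 \<le> X \<omega>"
    and X_mean: "expectation X = 1" and k_nonneg: "0 \<le> k"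
begin

lemma integrable_log2_gain: "integrable M (\<lambda>\<omega>. log 2 (1 + k * X \<omega>))"
proof (rule Bochner_Integration.integrable_bound)
  show "integrable M (\<lambda>\<omega>. k * X \<omega> / ln 2)"
    using X_int by simp
  show "(\<lambda>\<omega>. log 2 (1 + k * X \<omega>)) \<in> borel_measurable M"
    using borel_measurable_integrable[OF X_int] by measurable
  show "AE \<omega> in M. norm (log 2 (1 + k * X \<omega>)) \<le> norm (k * X \<omega> / ln 2)"
    using X_nonneg k_nonneg by (intro AE_I2) (simp add: log2_one_plus_le)
qed

lemma expectation_log2_gain_le: "expectation (\<lambda>\<omega>. log 2 (1 + k * X \<omega>)) \<le> k / ln 2"
proof -
  have "expectation (\<lambda>\<omega>. log 2 (1 + k * X \<omega>)) \<le> expectation (\<lambda>\<omega>. k * X \<omega> / ln 2)"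
    by (rule integral_mono[OF integrable_log2_gain])
      (use X_int X_nonneg k_nonneg log2_one_plus_le in auto)
  then show ?thesis by (simp add: X_mean)
qed

lemma expectation_log2_gain_nonneg: "0 \<le> expectation (\<lambda>\<omega>. log 2 (1 + k * X \<omega>))"
  by (rule integral_nonneg_AE) (use X_nonneg k_nonneg in simp)

text \<open>The integrand is nonnegative, so a vanishing expectation would force \<open>X\<close> to
  vanish almost everywhere, against its mean 1.\<close>

lemma expectation_log2_gain_pos:
  assumes "0 < k"
  shows "0 < expectation (\<lambda>\<omega>. log 2 (1 + k * X \<omega>))"
proof (rule ccontr)
  assume "\<not> ?thesis"
  then have "expectation (\<lambda>\<omega>. log 2 (1 + k * X \<omega>)) = 0"
    using expectation_log2_gain_nonneg by simp
  then have "AE \<omega> in M. log 2 (1 + k * X \<omega>) = 0"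
    using X_nonneg k_nonneg
    by (subst (asm) integral_nonneg_eq_0_iff_AE[OF integrable_log2_gain]) auto
  then have "AE \<omega> in M. X \<omega> = 0"
  proof (rule AE_mp, intro AE_I2 impI)
    fix \<omega> assume "log 2 (1 + k * X \<omega>) = 0"
    \<comment> \<open>At arguments that are not positive the value of the logarithm is a mere
      convention, so positivity must be known before concluding that the argument equals 1.\<close>
    moreover have "0 < 1 + k * X \<omega>"
      using X_nonneg[of \<omega>] assms by (simp add: add_pos_nonneg)
    ultimately have "1 + k * X \<omega> = 1"
      by (simp add: log_def)
    then show "X \<omega> = 0" using assms by simp
  qed
  then have "expectation X = 0"
    using integral_cong_AE[of X M "\<lambda>_. 0"] borel_measurable_integrable[OF X_int] by simp
  then show False using X_mean by simp
qed

end

end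

section \<open>Uniform quadratic bounds on the gains when \<open>P\<close> is a common bound for
  both transmit powers\<close>

locale powered_relay = relay M w m \<delta>s \<delta>r N0 \<sigma> \<alpha> Ps Pr + prob_space M
  for M :: "'a measure" and w m \<delta>s \<delta>r N0 \<sigma> \<alpha> Ps Pr +
  fixes P :: real
  assumes w_meas [measurable]: "\<And>l. w l \<in> borel_measurable M"
    and w_var: "\<And>l. expectation (\<lambda>\<omega>. (cmod (w l \<omega>))\<^sup>2) = 1"
    and m_gt_2: "2 < m"
    and \<delta>s: "0 < \<delta>s" "\<delta>s < 1"
    and \<delta>r: "0 < \<delta>r" "\<delta>r < 1"
    and N0_pos: "0 < N0"
    and \<sigma>_pos: "\<And>l. 0 < \<sigma> l"
    and \<alpha>: "0 < \<alpha>" "\<alpha> < 1"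
    and Ps: "0 \<le> Ps" "Ps \<le> P"
    and Pr: "0 \<le> Pr" "Pr \<le> P"
begin

abbreviation X :: "link \<Rightarrow> 'a \<Rightarrow> real" where
  "X l \<omega> \<equiv> (cmod (w l \<omega>))\<^sup>2"

(* The largest numerator over the smallest denominator; the factor 1 / (\<alpha> (1 - \<alpha>)) dominates the
   factors 1, 1 / \<alpha> and 1 / (1 - \<alpha>) of the different gains. *)
definition gain_max :: real where
  "gain_max = m\<^sup>2 * (\<sigma> SD ^ 4 + \<sigma> SR ^ 4 + \<sigma> RD ^ 4) / (\<alpha> * (1 - \<alpha>)) / ((m - 2) * N0 * N0) * P\<^sup>2"

text \<open>The integral of a non-integrable function is 0 by default, so the value 1 of the second
  moment already implies integrability.\<close>

lemma X_integrable: "integrable M (X l)"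
  using w_var[of l] not_integrable_integral_eq[of M "X l"] by fastforce

lemmas log2_gain_integrable = integrable_log2_gain[OF X_integrable zero_le_power2 w_var]
lemmas log2_gain_le = expectation_log2_gain_le[OF X_integrable zero_le_power2 w_var]
lemmas log2_gain_nonneg = expectation_log2_gain_nonneg[OF X_integrable zero_le_power2 w_var]
lemmas log2_gain_pos = expectation_log2_gain_pos[OF X_integrable zero_le_power2 w_var]

lemma noise_le: "N0 \<le> A" "N0 \<le> B" "N0 \<le> C"
  unfolding A_def B_def C_def using Ps Pr \<delta>s \<delta>r m_gt_2 by auto

text \<open>The parameter \<open>u\<close> collects the prefactors by which the schemes differ. The
  sum of the three fourth powers dominates each of them, so the bound does not depend on the
  link.\<close>

lemma gain_numerator:
  fixes \<delta> p u :: real and l :: link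
  assumes "0 < \<delta>" "\<delta> < 1" "0 \<le> p" "p \<le> P" "u \<in> {1, 1 / \<alpha>, 1 / (1 - \<alpha>)}"
  defines "x \<equiv> \<delta> * (1 - \<delta>) * m\<^sup>2 * p\<^sup>2 * \<sigma> l ^ 4 * u"
  shows "0 \<le> x"
    and "x \<le> m\<^sup>2 * (\<sigma> SD ^ 4 + \<sigma> SR ^ 4 + \<sigma> RD ^ 4) / (\<alpha> * (1 - \<alpha>)) * P\<^sup>2"
    and "0 < p \<Longrightarrow> 0 < x"
proof -
  \<comment> \<open>The product \<alpha> (1 - \<alpha>) is at most each of 1, \<alpha> and 1 -
    \<alpha>.\<close>
  have "1 / v \<le> 1 / (\<alpha> * (1 - \<alpha>))" if "v \<in> {1, \<alpha>, 1 - \<alpha>}" for v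
    using that \<alpha> by (intro frac_le) (auto simp: mult_le_one mult_left_le mult_left_le_one_le)
  from this[of 1] this[of \<alpha>] this[of "1 - \<alpha>"]
  have u: "0 < u" "u \<le> 1 / (\<alpha> * (1 - \<alpha>))"
    using assms(5) \<alpha> by auto
  show "0 \<le> x" "0 < p \<Longrightarrow> 0 < x"
    using assms u \<sigma>_pos[of l] m_gt_2 by auto
  have "\<sigma> l ^ 4 \<le> \<sigma> SD ^ 4 + \<sigma> SR ^ 4 + \<sigma> RD ^ 4"
    by (cases l) auto
  moreover have "p\<^sup>2 \<le> P\<^sup>2"
    using assms by (simp add: power_mono)
  ultimately have "m\<^sup>2 * p\<^sup>2 * \<sigma> l ^ 4 * u
      \<le> m\<^sup>2 * P\<^sup>2 * (\<sigma> SD ^ 4 + \<sigma> SR ^ 4 + \<sigma> RD ^ 4) * (1 / (\<alpha> * (1 - \<alpha>)))"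
    using u by (intro mult_mono) auto
  moreover have "x \<le> m\<^sup>2 * p\<^sup>2 * \<sigma> l ^ 4 * u"
    using mult_three_le[of \<delta> "1 - \<delta>" "m\<^sup>2 * p\<^sup>2 * \<sigma> l ^ 4 * u"] assms u
    by (simp add: x_def mult.assoc)
  ultimately show "x \<le> m\<^sup>2 * (\<sigma> SD ^ 4 + \<sigma> SR ^ 4 + \<sigma> RD ^ 4) / (\<alpha> * (1 - \<alpha>)) * P\<^sup>2"
    by (simp add: mult_ac)
qed

text \<open>The lower bound on \<open>y\<close> is the pure noise part of a denominator, which
  survives when the powers tend to 0; this is why the gain stays quadratic in the power.\<close>

lemma gain_bounds:
  fixes \<delta> p u y :: real and l :: link
  assumes "0 < \<delta>" "\<delta> < 1" "0 \<le> p" "p \<le> P" "u \<in> {1, 1 / \<alpha>, 1 / (1 - \<alpha>)}"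
    and "(m - 2) * N0 * N0 \<le> y"
  defines "k \<equiv> \<delta> * (1 - \<delta>) * m\<^sup>2 * p\<^sup>2 * \<sigma> l ^ 4 * u / y"
  shows "0 \<le> k" "k \<le> gain_max" "0 < p \<Longrightarrow> 0 < k"
proof -
  note num = gain_numerator[OF assms(1-5), of l]
  have "0 < (m - 2) * N0 * N0" using m_gt_2 N0_pos by simp
  note bounds = frac_bounds[OF num(1,2) this assms(6), of gain_max, folded k_def]
  show "0 \<le> k" "k \<le> gain_max" "0 < p \<Longrightarrow> 0 < k"
    using bounds num(3) by (simp_all add: gain_max_def)
qed

(* D itself grows with the product A B; cancelling the factor B in b, resp. A in d, makes the
   numerators comparable to those of the other gains. *)
lemma
  shows D_over_B: "D / B = (m - 2) * A * N0 + (1 - \<delta>r) * m * Pr * (\<sigma> RD)\<^sup>2 * N0 * A / \<alpha> / B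
      + (1 - \<delta>s) * m * Ps * (\<sigma> SD)\<^sup>2 * N0"
    and D_over_A: "D / A = (m - 2) * B * N0 + (1 - \<delta>r) * m * Pr * (\<sigma> RD)\<^sup>2 * N0 / \<alpha>
      + (1 - \<delta>s) * m * Ps * (\<sigma> SD)\<^sup>2 * N0 * B / A"
proof -
  have "A \<noteq> 0" "B \<noteq> 0" using noise_le N0_pos by auto
  then show "D / B = (m - 2) * A * N0 + (1 - \<delta>r) * m * Pr * (\<sigma> RD)\<^sup>2 * N0 * A / \<alpha> / B
      + (1 - \<delta>s) * m * Ps * (\<sigma> SD)\<^sup>2 * N0"
    "D / A = (m - 2) * B * N0 + (1 - \<delta>r) * m * Pr * (\<sigma> RD)\<^sup>2 * N0 / \<alpha>
      + (1 - \<delta>s) * m * Ps * (\<sigma> SD)\<^sup>2 * N0 * B / A"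
    unfolding D_def by (simp_all add: add_divide_distrib)
qed

lemma noise_terms_le:
  assumes "N0 \<le> Y" "0 \<le> v"
  shows "(m - 2) * N0 * N0 \<le> v + (m - 2) * Y * N0"
proof -
  have "(m - 2) * N0 * N0 \<le> (m - 2) * Y * N0"
    using assms m_gt_2 N0_pos by (intro mult_right_mono mult_left_mono) auto
  then show ?thesis using assms by simp
qed

text \<open>From here on each gain is seen only through a coefficient \<open>k\<close> with bounds.
  Strict positivity is recorded for the gains driven by \<open>Ps\<close> on which positivity of the
  rates rests; the gains of the relay-destination link vanish if \<open>Pr = 0\<close>, that is, if
  \<theta> = 1.\<close>

lemma a_gain: obtains k where "0 \<le> k" "k \<le> gain_max" "0 < Ps \<Longrightarrow> 0 < k" "a = (\<lambda>\<omega>. k * X SD \<omega>)"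
proof -
  have bound: "(m - 2) * N0 * N0 \<le> (1 - \<delta>s) * m * Ps * (\<sigma> SD)\<^sup>2 * N0 + (m - 2) * A * N0"
    using \<delta>s m_gt_2 Ps N0_pos by (intro noise_terms_le noise_le) auto
  show thesis
    by (rule that[OF gain_bounds[OF \<delta>s Ps _ bound, of 1 SD]]) (auto simp: a_def fun_eq_iff)
qed

lemma c_gain: obtains k where "0 \<le> k" "k \<le> gain_max" "0 < Ps \<Longrightarrow> 0 < k" "c = (\<lambda>\<omega>. k * X SR \<omega>)"
proof -
  have bound: "(m - 2) * N0 * N0 \<le> (1 - \<delta>s) * m * Ps * (\<sigma> SR)\<^sup>2 * N0 + (m - 2) * C * N0"
    using \<delta>s m_gt_2 Ps N0_pos by (intro noise_terms_le noise_le) auto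
  show thesis
    by (rule that[OF gain_bounds[OF \<delta>s Ps _ bound, of 1 SR]]) (auto simp: c_def fun_eq_iff)
qed

lemma b_gain: obtains k where "0 \<le> k" "k \<le> gain_max" "b = (\<lambda>\<omega>. k * X SD \<omega>)"
proof -
  have bound: "(m - 2) * N0 * N0 \<le> D / B"
    using noise_terms_le[OF noise_le(1), of "(1 - \<delta>r) * m * Pr * (\<sigma> RD)\<^sup>2 * N0 * A / \<alpha> / B
      + (1 - \<delta>s) * m * Ps * (\<sigma> SD)\<^sup>2 * N0"]
      \<delta>s \<delta>r m_gt_2 Ps Pr N0_pos \<alpha> noise_le unfolding D_over_B by (simp add: add_ac)
  show thesis
    by (rule that[OF gain_bounds(1,2)[OF \<delta>s Ps _ bound, of 1 SD]]) (auto simp: b_def fun_eq_iff)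
qed

lemma d_gain: obtains k where "0 \<le> k" "k \<le> gain_max" "d = (\<lambda>\<omega>. k * X RD \<omega>)"
proof -
  have bound: "(m - 2) * N0 * N0 \<le> D / A"
    using noise_terms_le[OF noise_le(2), of "(1 - \<delta>r) * m * Pr * (\<sigma> RD)\<^sup>2 * N0 / \<alpha>
      + (1 - \<delta>s) * m * Ps * (\<sigma> SD)\<^sup>2 * N0 * B / A"]
      \<delta>s \<delta>r m_gt_2 Ps Pr N0_pos \<alpha> noise_le unfolding D_over_A by (simp add: add_ac)
  show thesis
    \<comment> \<open>The denominator is taken to be \<open>D / A\<close>, and the factor 1 /
      \<alpha> in the numerator is the \<open>u\<close> of the bound.\<close>
    by (rule that[OF gain_bounds(1,2)[OF \<delta>r Pr _ bound, of "1 / \<alpha>" RD]]) (auto simp: d_def fun_eq_iff)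
qed

lemma a\<^sub>1_gain: obtains k where "0 \<le> k" "k \<le> gain_max" "0 < Ps \<Longrightarrow> 0 < k" "a\<^sub>1 = (\<lambda>\<omega>. k * X SD \<omega>)"
proof -
  have bound: "(m - 2) * N0 * N0 \<le> (1 - \<delta>s) * m * Ps * (\<sigma> SD)\<^sup>2 * N0 / (1 - \<alpha>) + (m - 2) * A * N0"
    using \<delta>s m_gt_2 Ps N0_pos \<alpha> by (intro noise_terms_le noise_le) auto
  show thesis
    by (rule that[OF gain_bounds[OF \<delta>s Ps _ bound, of "1 / (1 - \<alpha>)" SD]]) (auto simp: a\<^sub>1_def fun_eq_iff)
qed

lemma c\<^sub>1_gain: obtains k where "0 \<le> k" "k \<le> gain_max" "0 < Ps \<Longrightarrow> 0 < k" "c\<^sub>1 = (\<lambda>\<omega>. k * X SR \<omega>)"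
proof -
  have bound: "(m - 2) * N0 * N0 \<le> (1 - \<delta>s) * m * Ps * (\<sigma> SR)\<^sup>2 * N0 / (1 - \<alpha>) + (m - 2) * C * N0"
    using \<delta>s m_gt_2 Ps N0_pos \<alpha> by (intro noise_terms_le noise_le) auto
  show thesis
    by (rule that[OF gain_bounds[OF \<delta>s Ps _ bound, of "1 / (1 - \<alpha>)" SR]]) (auto simp: c\<^sub>1_def fun_eq_iff)
qed

lemma d\<^sub>1_gain: obtains k where "0 \<le> k" "k \<le> gain_max" "d\<^sub>1 = (\<lambda>\<omega>. k * X RD \<omega>)"
proof -
  have bound: "(m - 2) * N0 * N0 \<le> (1 - \<delta>r) * m * Pr * (\<sigma> RD)\<^sup>2 * N0 / \<alpha> + (m - 2) * B * N0"
    using \<delta>r m_gt_2 Pr N0_pos \<alpha> by (intro noise_terms_le noise_le) auto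
  show thesis
    by (rule that[OF gain_bounds(1,2)[OF \<delta>r Pr _ bound, of "1 / \<alpha>" RD]]) (auto simp: d\<^sub>1_def fun_eq_iff)
qed

section \<open>Upper bounds and positivity for the rates of the three schemes\<close>

lemma gain_max_nonneg: "0 \<le> gain_max"
  unfolding gain_max_def using m_gt_2 N0_pos \<alpha> by simp

lemma log2_gain_le_max:
  assumes "0 \<le> k" "k \<le> gain_max"
  shows "expectation (\<lambda>\<omega>. log 2 (1 + k * X l \<omega>)) \<le> gain_max / ln 2"
proof -
  have "k / ln 2 \<le> gain_max / ln 2"
    using assms by (intro divide_right_mono) auto
  then show ?thesis
    using log2_gain_le[OF assms(1), of l] by (rule order_trans[rotated])
qed

text \<open>(1 - \<alpha>) (m - 2) is the sum of the weights (1 - 2 \<alpha>) (m - 2) and \<alpha>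
  (m - 2) of the two logarithms in the first two schemes, and a weight by itself in the parallel
  one.\<close>

lemma direct_weight_le: "(1 - \<alpha>) * (m - 2) \<le> m"
proof -
  have "(1 - \<alpha>) * (m - 2) \<le> m - 2"
    using \<alpha> m_gt_2 by (intro mult_left_le_one_le) auto
  then show ?thesis by simp
qed

text \<open>The integrand \<open>G\<close> is squeezed between a positive multiple of log (1 + a)
  and \<open>m * U\<close>. The lower bound gives positivity; the three gains in \<open>U\<close>
  give the constant 3.\<close>

lemma AF_rate:
  assumes "\<alpha> \<le> 1/2"
  shows "rate AF \<le> 3 * gain_max / ln 2" "0 < Ps \<Longrightarrow> 0 < rate AF"
proof -
  obtain ka where ka: "0 \<le> ka" "ka \<le> gain_max" "0 < Ps \<Longrightarrow> 0 < ka" and a: "a = (\<lambda>\<omega>. ka * X SD \<omega>)"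
    by (rule a_gain) blast
  obtain kb where kb: "0 \<le> kb" "kb \<le> gain_max" and b: "b = (\<lambda>\<omega>. kb * X SD \<omega>)"
    by (rule b_gain)
  obtain kc where kc: "0 \<le> kc" "kc \<le> gain_max" and c: "c = (\<lambda>\<omega>. kc * X SR \<omega>)"
    by (rule c_gain) blast
  obtain kd where kd: "0 \<le> kd" "kd \<le> gain_max" and d: "d = (\<lambda>\<omega>. kd * X RD \<omega>)"
    by (rule d_gain)
  have nonneg: "0 \<le> a \<omega>" "0 \<le> b \<omega>" "0 \<le> c \<omega>" "0 \<le> d \<omega>" for \<omega>
    using ka kb kc kd by (simp_all add: a b c d)
  define F where "F \<omega> = 1 + a \<omega> + c \<omega> * d \<omega> / (1 + c \<omega> + d \<omega>)
      + (1 + a \<omega>) * b \<omega> * (1 + c \<omega>) / (1 + c \<omega> + d \<omega>)" for \<omega>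
  define U where "U \<omega> = log 2 (1 + a \<omega>) + log 2 (1 + b \<omega>) + log 2 (1 + c \<omega>)" for \<omega>
  define G where "G \<omega> = (1 - 2 * \<alpha>) * (m - 2) * log 2 (1 + a \<omega>) + (m - 2) * \<alpha> * log 2 (F \<omega>)" for \<omega>
  have log_nonneg: "0 \<le> log 2 (1 + a \<omega>)" "0 \<le> log 2 (1 + b \<omega>)" "0 \<le> log 2 (1 + c \<omega>)" for \<omega>
    using nonneg by simp_all
  have F_lower: "1 + a \<omega> \<le> F \<omega>" for \<omega>
    using nonneg[of \<omega>] by (simp add: F_def)
  have F_upper: "F \<omega> \<le> (1 + a \<omega>) * (1 + b \<omega>) * (1 + c \<omega>)" for \<omega>
  proof -
    \<comment> \<open>The gain \<open>d\<close> disappears here: both d and 1 + c are at most 1 + c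
      + d.\<close>
    have "c \<omega> * d \<omega> / (1 + c \<omega> + d \<omega>) \<le> c \<omega>"
      using nonneg[of \<omega>] by (simp add: pos_divide_le_eq algebra_simps)
    moreover have "(1 + a \<omega>) * b \<omega> * (1 + c \<omega>) / (1 + c \<omega> + d \<omega>) \<le> (1 + a \<omega>) * b \<omega>"
      using nonneg[of \<omega>] by (simp add: pos_divide_le_eq algebra_simps)
    ultimately have "F \<omega> \<le> (1 + a \<omega>) * (1 + b \<omega>) + c \<omega>"
      by (simp add: F_def algebra_simps)
    \<comment> \<open>Holds because the factor (1 + a) (1 + b) multiplying \<open>c\<close> on the
      right is at least 1.\<close>
    also have "\<dots> \<le> (1 + a \<omega>) * (1 + b \<omega>) * (1 + c \<omega>)"
      using nonneg[of \<omega>] by (simp add: algebra_simps)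
    finally show ?thesis .
  qed
  have logF: "log 2 (1 + a \<omega>) \<le> log 2 (F \<omega>)" "log 2 (F \<omega>) \<le> U \<omega>" for \<omega>
    using F_lower[of \<omega>] F_upper[of \<omega>] nonneg[of \<omega>] unfolding U_def
    by (auto intro!: log2_le_sum_log2)
  have G_lower: "(1 - \<alpha>) * (m - 2) * log 2 (1 + a \<omega>) \<le> G \<omega>" for \<omega>
    using mult_left_mono[OF logF(1), of "(m - 2) * \<alpha>" \<omega>] m_gt_2 \<alpha>
    by (simp add: G_def algebra_simps)
  have G_upper: "G \<omega> \<le> m * U \<omega>" for \<omega>
  proof -
    have "log 2 (1 + a \<omega>) \<le> U \<omega>" using logF order_trans by blast
    \<comment> \<open>The assumption \<alpha> \<le> 1/2 keeps the weight 1 - 2 \<alpha>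
      nonnegative.\<close>
    then have "G \<omega> \<le> (1 - 2 * \<alpha>) * (m - 2) * U \<omega> + (m - 2) * \<alpha> * U \<omega>"
      unfolding G_def using logF assms \<alpha> m_gt_2 by (intro add_mono mult_left_mono) auto
    also have "\<dots> = ((1 - \<alpha>) * (m - 2)) * U \<omega>" by (simp add: algebra_simps)
    also have "\<dots> \<le> m * U \<omega>"
      using log_nonneg[of \<omega>] by (intro mult_right_mono direct_weight_le) (simp add: U_def)
    finally show ?thesis .
  qed
  have U_int: "integrable M U"
    unfolding U_def a b c using ka kb kc
    by (intro Bochner_Integration.integrable_add log2_gain_integrable)
  have log_a_int: "integrable M (\<lambda>\<omega>. log 2 (1 + a \<omega>))"
    unfolding a using ka by (intro log2_gain_integrable)
  have G_int: "integrable M G"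
  proof (rule Bochner_Integration.integrable_bound)
    show "integrable M (\<lambda>\<omega>. m * U \<omega>)" using U_int by simp
    show "G \<in> borel_measurable M"
      unfolding G_def F_def a b c d by measurable
    show "AE \<omega> in M. norm (G \<omega>) \<le> norm (m * U \<omega>)"
    proof (intro AE_I2)
      fix \<omega>
      \<comment> \<open>With \<open>G\<close> nonnegative, the upper bound on \<open>G\<close> is
        also a bound on its norm.\<close>
      have "0 \<le> G \<omega>"
        using log_nonneg(1) \<alpha> m_gt_2 by (intro order_trans[OF _ G_lower]) auto
      then show "norm (G \<omega>) \<le> norm (m * U \<omega>)" using G_upper[of \<omega>] by simp
    qed
  qed
  have rate_eq: "rate AF = 1 / m * expectation G"
    by (simp add: G_def[abs_def] F_def)
  have "expectation G \<le> expectation (\<lambda>\<omega>. m * U \<omega>)"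
    by (rule integral_mono[OF G_int _ G_upper]) (use U_int in simp)
  also have "\<dots> = m * expectation U"
    by simp
  also have "expectation U = expectation (\<lambda>\<omega>. log 2 (1 + a \<omega>))
      + expectation (\<lambda>\<omega>. log 2 (1 + b \<omega>)) + expectation (\<lambda>\<omega>. log 2 (1 + c \<omega>))"
    unfolding U_def a b c using ka kb kc by (simp add: log2_gain_integrable)
  also have "m * \<dots> \<le> m * (gain_max / ln 2 + gain_max / ln 2 + gain_max / ln 2)"
    unfolding a b c using ka kb kc m_gt_2
    by (intro mult_left_mono add_mono log2_gain_le_max) auto
  also have "\<dots> = m * (3 * gain_max / ln 2)"
    by simp
  finally have "expectation G \<le> m * (3 * gain_max / ln 2)" .
  then show "rate AF \<le> 3 * gain_max / ln 2"
    using m_gt_2 unfolding rate_eq by (simp add: pos_divide_le_eq mult.commute)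
  assume "0 < Ps"
  then have "0 < (1 - \<alpha>) * (m - 2) * expectation (\<lambda>\<omega>. log 2 (1 + a \<omega>))"
    unfolding a using ka \<alpha> m_gt_2 by (intro mult_pos_pos log2_gain_pos) auto
  also have "\<dots> = expectation (\<lambda>\<omega>. (1 - \<alpha>) * (m - 2) * log 2 (1 + a \<omega>))"
    by simp
  also have "\<dots> \<le> expectation G"
    by (rule integral_mono[OF _ G_int G_lower]) (use log_a_int in simp)
  finally show "0 < rate AF" using m_gt_2 by (simp add: rate_eq del: rate.simps)
qed

text \<open>For the upper bound the minimum is replaced by its source-relay branch. For positivity
  both branches are needed: the second one dominates E log (1 + a) because its argument is at least
  1 + a.\<close>

lemma DF_Repetition_rate:
  assumes "\<alpha> \<le> 1/2"
  shows "rate DF_Repetition \<le> 3 * gain_max / ln 2" "0 < Ps \<Longrightarrow> 0 < rate DF_Repetition"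
proof -
  obtain ka where ka: "0 \<le> ka" "ka \<le> gain_max" "0 < Ps \<Longrightarrow> 0 < ka" and a: "a = (\<lambda>\<omega>. ka * X SD \<omega>)"
    by (rule a_gain) blast
  obtain kb where kb: "0 \<le> kb" "kb \<le> gain_max" and b: "b = (\<lambda>\<omega>. kb * X SD \<omega>)"
    by (rule b_gain)
  obtain kc where kc: "0 \<le> kc" "kc \<le> gain_max" "0 < Ps \<Longrightarrow> 0 < kc" and c: "c = (\<lambda>\<omega>. kc * X SR \<omega>)"
    by (rule c_gain) blast
  obtain kd where kd: "0 \<le> kd" "kd \<le> gain_max" and d: "d = (\<lambda>\<omega>. kd * X RD \<omega>)"
    by (rule d_gain)
  have nonneg: "0 \<le> a \<omega>" "0 \<le> b \<omega>" "0 \<le> d \<omega>" for \<omega>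
    using ka kb kd by (simp_all add: a b d)
  let ?Ea = "expectation (\<lambda>\<omega>. log 2 (1 + a \<omega>))" and ?Ec = "expectation (\<lambda>\<omega>. log 2 (1 + c \<omega>))"
  define F where "F \<omega> = 1 + a \<omega> + d \<omega> + b \<omega> + a \<omega> * b \<omega>" for \<omega>
  define U where "U \<omega> = log 2 (1 + a \<omega>) + log 2 (1 + b \<omega>) + log 2 (1 + d \<omega>)" for \<omega>
  have "F \<omega> \<le> (1 + a \<omega>) * (1 + b \<omega>) * (1 + d \<omega>)" "1 + a \<omega> \<le> F \<omega>" for \<omega>
    using nonneg[of \<omega>] by (simp_all add: F_def algebra_simps)
  then have logF: "log 2 (1 + a \<omega>) \<le> log 2 (F \<omega>)" "log 2 (F \<omega>) \<le> U \<omega>" for \<omega>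
    using nonneg[of \<omega>] unfolding U_def
    by (auto intro!: log2_le_sum_log2 simp: F_def add_pos_nonneg)
  have U_int: "integrable M U"
    unfolding U_def a b d using ka kb kd
    by (intro Bochner_Integration.integrable_add log2_gain_integrable)
  have log_a_int: "integrable M (\<lambda>\<omega>. log 2 (1 + a \<omega>))"
    unfolding a using ka by (intro log2_gain_integrable)
  \<comment> \<open>Without integrability the expectation of log F would default to 0 and could not
    be compared with that of log (1 + a). This is the purpose of \<open>U\<close> here.\<close>
  have F_int: "integrable M (\<lambda>\<omega>. log 2 (F \<omega>))"
  proof (rule Bochner_Integration.integrable_bound[OF U_int])
    show "(\<lambda>\<omega>. log 2 (F \<omega>)) \<in> borel_measurable M"
      unfolding F_def a b d by measurable
    have "0 \<le> log 2 (F \<omega>)" for \<omega>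
      using nonneg(1) by (rule order_trans[OF log2_one_plus_nonneg logF(1)])
    then show "AE \<omega> in M. norm (log 2 (F \<omega>)) \<le> norm (U \<omega>)"
      using logF(2) by (simp add: abs_le_iff order_trans[OF _ abs_ge_self])
  qed
  let ?min = "min ?Ec (expectation (\<lambda>\<omega>. log 2 (F \<omega>)))"
  have rate_eq: "rate DF_Repetition = 1 / m * ((1 - 2 * \<alpha>) * (m - 2) * ?Ea + (m - 2) * \<alpha> * ?min)"
    by (simp add: F_def)
  have gain: "3 * (gain_max / ln 2) = 3 * gain_max / ln 2" "0 \<le> gain_max / ln 2"
    using gain_max_nonneg by simp_all
  have Ea: "?Ea \<le> gain_max / ln 2" "0 \<le> ?Ea"
    unfolding a using ka(1,2) by (simp_all add: log2_gain_le_max log2_gain_nonneg)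
  have Ec: "?Ec \<le> gain_max / ln 2"
    unfolding c using kc(1,2) by (rule log2_gain_le_max)
  have "(1 - 2 * \<alpha>) * (m - 2) * ?Ea + (m - 2) * \<alpha> * ?min
      \<le> (1 - 2 * \<alpha>) * (m - 2) * (gain_max / ln 2) + (m - 2) * \<alpha> * (gain_max / ln 2)"
    using Ea Ec assms \<alpha> m_gt_2 by (intro add_mono mult_left_mono) (auto simp: min_le_iff_disj)
  also have "\<dots> = ((1 - \<alpha>) * (m - 2)) * (gain_max / ln 2)" by (simp add: field_simps)
  \<comment> \<open>The factor 3 is slack, introduced to reach the constant shared by all
    schemes.\<close>
  also have "\<dots> \<le> m * (3 * (gain_max / ln 2))"
    using direct_weight_le m_gt_2 gain by (intro mult_mono) auto
  finally show "rate DF_Repetition \<le> 3 * gain_max / ln 2"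
    using m_gt_2 unfolding rate_eq gain by (simp add: pos_divide_le_eq mult.commute)
  assume "0 < Ps"
  then have "0 < ?Ea" "0 < ?Ec"
    unfolding a c using ka kc by (auto intro!: log2_gain_pos)
  moreover have "?Ea \<le> expectation (\<lambda>\<omega>. log 2 (F \<omega>))"
    by (rule integral_mono[OF log_a_int F_int logF(1)])
  ultimately have "0 < ?min" by simp
  then have "0 < (m - 2) * \<alpha> * ?min"
    using \<alpha> m_gt_2 by (intro mult_pos_pos) auto
  moreover have "0 \<le> (1 - 2 * \<alpha>) * (m - 2) * ?Ea"
    using Ea assms m_gt_2 by simp
  ultimately show "0 < rate DF_Repetition"
    using m_gt_2 unfolding rate_eq by (intro mult_pos_pos) auto
qed

text \<open>The source-relay branch alone bounds the minimum from above. Both branches are positive,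
  the second one through the gain of the direct link.\<close>

lemma DF_Parallel_rate:
  shows "rate DF_Parallel \<le> 3 * gain_max / ln 2" "0 < Ps \<Longrightarrow> 0 < rate DF_Parallel"
proof -
  obtain ka where ka: "0 \<le> ka" "0 < Ps \<Longrightarrow> 0 < ka" and a: "a\<^sub>1 = (\<lambda>\<omega>. ka * X SD \<omega>)"
    by (rule a\<^sub>1_gain) blast
  obtain kc where kc: "0 \<le> kc" "kc \<le> gain_max" "0 < Ps \<Longrightarrow> 0 < kc" and c: "c\<^sub>1 = (\<lambda>\<omega>. kc * X SR \<omega>)"
    by (rule c\<^sub>1_gain) blast
  obtain kd where kd: "0 \<le> kd" and d: "d\<^sub>1 = (\<lambda>\<omega>. kd * X RD \<omega>)"
    by (rule d\<^sub>1_gain)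
  let ?Ea = "expectation (\<lambda>\<omega>. log 2 (1 + ka * X SD \<omega>))"
    and ?Ec = "expectation (\<lambda>\<omega>. log 2 (1 + kc * X SR \<omega>))"
    and ?Ed = "expectation (\<lambda>\<omega>. log 2 (1 + kd * X RD \<omega>))"
  \<comment> \<open>Integrability of the two logarithms allows the expectation in the second branch
    to be split.\<close>
  have rate_eq: "rate DF_Parallel = min ((1 - \<alpha>) * (m - 2) / m * ?Ec)
      ((1 - \<alpha>) * (m - 2) / m * ?Ea + \<alpha> * (m - 2) / m * ?Ed)"
    using ka kc kd by (simp add: a c d log2_gain_integrable)
  have weight: "0 < (1 - \<alpha>) * (m - 2) / m" "(1 - \<alpha>) * (m - 2) / m \<le> 1"
    using direct_weight_le \<alpha> m_gt_2 by (auto simp: pos_divide_le_eq)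
  have "(1 - \<alpha>) * (m - 2) / m * ?Ec \<le> ?Ec"
    using weight log2_gain_nonneg[OF kc(1)] by (intro mult_left_le_one_le) auto
  also have "\<dots> \<le> gain_max / ln 2"
    using kc(1,2) by (rule log2_gain_le_max)
  also have "\<dots> \<le> 3 * gain_max / ln 2"
    using gain_max_nonneg by (intro divide_right_mono) auto
  finally show "rate DF_Parallel \<le> 3 * gain_max / ln 2"
    unfolding rate_eq by (simp only: min.coboundedI1)
  assume Ps_pos: "0 < Ps"
  have "0 < (1 - \<alpha>) * (m - 2) / m * ?Ec" "0 < (1 - \<alpha>) * (m - 2) / m * ?Ea"
    using weight ka kc Ps_pos by (intro mult_pos_pos log2_gain_pos; simp)+
  moreover have "0 \<le> \<alpha> * (m - 2) / m * ?Ed"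
    using \<alpha> m_gt_2 log2_gain_nonneg[OF kd, of RD] by (intro mult_nonneg_nonneg) auto
  ultimately show "0 < rate DF_Parallel"
    unfolding rate_eq by (simp only: min_less_iff_conj add_pos_nonneg simp_thms)
qed

lemma rate_bounds:
  assumes "admissible sch \<alpha>"
  shows "rate sch \<le> 3 * gain_max / ln 2" "0 < Ps \<Longrightarrow> 0 < rate sch"
  using assms AF_rate DF_Repetition_rate DF_Parallel_rate
  by (cases sch; simp del: rate.simps)+

end

section \<open>From a quadratic bound to the derivative at 0 and the limit of the bit energy\<close>

lemma zero_slope_if_quadratic:
  fixes f :: "real \<Rightarrow> real"
  assumes "f 0 = 0" "\<And>x. 0 < x \<Longrightarrow> 0 < f x" "\<And>x. 0 < x \<Longrightarrow> f x \<le> K * x\<^sup>2"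
  shows "filterlim (\<lambda>x. x / f x) at_top (at_right 0)"
    and "(f has_real_derivative 0) (at_right 0)"
proof -
  have pos: "eventually (\<lambda>x::real. 0 < x) (at_right 0)"
    by (rule eventually_at_right_less)
  have quot: "f x / x \<le> K * x" if "0 < x" for x
    using assms(3)[OF that] that by (simp add: pos_divide_le_eq power2_eq_square mult_ac)
  \<comment> \<open>Since f 0 = 0, this is the difference quotient at 0; it lies between 0 and K
    x.\<close>
  have tendsto: "((\<lambda>x. f x / x) \<longlongrightarrow> 0) (at_right 0)"
  proof (rule tendsto_sandwich)
    show "eventually (\<lambda>x. 0 \<le> f x / x) (at_right 0)"
      using pos by eventually_elim (simp add: assms(2) less_imp_le)
    show "eventually (\<lambda>x. f x / x \<le> K * x) (at_right 0)"
      using pos by eventually_elim (rule quot)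
    show "((\<lambda>x. K * x) \<longlongrightarrow> 0) (at_right 0)"
      by (auto intro!: tendsto_eq_intros)
  qed simp
  then show "(f has_real_derivative 0) (at_right 0)"
    by (simp add: has_field_derivative_iff assms(1))
  \<comment> \<open>Positivity of \<open>f\<close> makes the quotient approach 0 from above, so its
    reciprocal tends to plus infinity.\<close>
  have "filterlim (\<lambda>x. inverse (f x / x)) at_top (at_right 0)"
    using tendsto pos by (intro filterlim_inverse_at_top)
      (auto elim!: eventually_mono simp: assms(2))
  then show "filterlim (\<lambda>x. x / f x) at_top (at_right 0)"
    by simp
qed

theorem theorem4:
  fixes M :: "'a measure"
    and w :: "link \<Rightarrow> 'a \<Rightarrow> complex"
    and m \<delta>s \<delta>r N0 \<theta> \<alpha> :: real
    and \<sigma> :: "link \<Rightarrow> real"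
    and sch :: scheme
  defines "R \<equiv> I_low M w m \<delta>s \<delta>r N0 \<sigma> \<theta> \<alpha> sch"
  assumes "prob_space M"
    and "prob_space.indep_vars M (\<lambda>_. borel) w UNIV"
    and "\<And>l. proper_complex_gaussian M (w l) 0 1"
    and "m > 2"
    and "0 < \<delta>s" "\<delta>s < 1" "0 < \<delta>r" "\<delta>r < 1"
    and "0 < \<theta>" "\<theta> \<le> 1"
    and "N0 > 0"
    and "\<And>l. \<sigma> l > 0"
    and "admissible sch \<alpha>"
  shows "R 0 = 0
    \<and> filterlim (normalized_bit_energy R) at_top (at_right 0)
    \<and> (R has_real_derivative 0) (at_right 0)"
proof -
  have R0: "R 0 = 0"
    by (cases sch) (simp_all add: R_def I_low_def relay.rate.simps relay.a_def relay.b_def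
        relay.c_def relay.d_def relay.a\<^sub>1_def relay.c\<^sub>1_def relay.d\<^sub>1_def)
  have \<alpha>: "0 < \<alpha>" "\<alpha> < 1"
    using assms(14) by (cases sch; simp)+
  \<comment> \<open>This is the common rate bound \<open>3 * gain_max / ln 2\<close> at P = x N0,
    with the factor x^2 taken out.\<close>
  define K where "K = 3 * (m\<^sup>2 * (\<sigma> SD ^ 4 + \<sigma> SR ^ 4 + \<sigma> RD ^ 4) / (\<alpha> * (1 - \<alpha>))
      / ((m - 2) * N0 * N0) * N0\<^sup>2) / ln 2"
  have bounds: "0 < R x \<and> R x \<le> K * x\<^sup>2" if "0 < x" for x
  proof -
    interpret prob_space M by fact
    have channel: "w l \<in> borel_measurable M" "expectation (\<lambda>\<omega>. (cmod (w l \<omega>))\<^sup>2) = 1" for l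
      using assms(4)[of l] by (simp_all add: proper_complex_gaussian_def)
    \<comment> \<open>The common power bound is the total power x N0, since \<theta> and 1 -
      \<theta> lie in [0, 1].\<close>
    interpret powered_relay M w m \<delta>s \<delta>r N0 \<sigma> \<alpha> "\<theta> * (x * N0)" "(1 - \<theta>) * (x * N0)" "x * N0"
      by unfold_locales
        (use assms(5-13) \<alpha> channel that in \<open>auto intro!: mult_left_le_one_le\<close>)
    have Ps_pos: "0 < \<theta> * (x * N0)" using assms(10,12) that by simp
    have "K * x\<^sup>2 = 3 * gain_max / ln 2"
      unfolding K_def gain_max_def by (simp add: power_mult_distrib)
    then show ?thesis
      using rate_bounds(1)[OF assms(14)] rate_bounds(2)[OF assms(14) Ps_pos]
      by (simp add: R_def I_low_def)
  qed
  have "normalized_bit_energy R = (\<lambda>x. x / R x)"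
    by (simp add: normalized_bit_energy_def fun_eq_iff)
  then show ?thesis
    using R0 bounds zero_slope_if_quadratic[of R K] by auto
qed

end
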